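(* Let $a$ and $b$ be nonnegative real parameters with $a\neq b$, let $x\in[a,b]$, let $t\in\mathbb{C}$, let $m$ be a positive integer and $k$ a nonnegative integer. Let $v$ be a nonnegative integer. Then $$\frac{\partial^{v}f_{\mathbb{Y},k}(x,t;a,b,m)}{\partial t^{v}}=\sum_{j=0}^{v}(b-a)^{v-j}\,\mathbb{Y}_{j}^{v}(x;a,b,v)\,f_{\mathbb{Y},k-j}(x,t;a,b,m-j).$$
   Context: Here $[a,b]=\{x\in\mathbb{R}: a\le x\le b\}$ (so $a<b$). For an integer $m$ and a nonnegative integer $k$, $$f_{\mathbb{Y},k}(x,t;a,b,m)=\frac{t^{k}(x-a)^{k}e^{(b-x)t}}{(b-a)^{m}\,k!},$$ and $f_{\mathbb{Y},k}=0$ when $k<0$. For nonnegative integers $j\le v$, $$\mathbb{Y}_{j}^{v}(x;a,b,v)=\binom{v}{j}\frac{(x-a)^{j}(b-x)^{v-j}}{(b-a)^{v}}.$$ Convention: $0^0=1$. *)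

theory Defs
  imports "HOL-Analysis.Analysis"
begin

text \<open>The order \<open>k\<close> and the exponent \<open>m\<close> are integers, because both may
  become negative after an index shift; hence \<open>powi\<close> for the power of \<open>b - a\<close>.\<close>

definition f_Y :: "int \<Rightarrow> real \<Rightarrow> complex \<Rightarrow> real \<Rightarrow> real \<Rightarrow> int \<Rightarrow> complex" where
  "f_Y k x t a b m =
     (if k < 0 then 0
      else t ^ nat k * of_real (x - a) ^ nat k * exp (of_real (b - x) * t)
             / (of_real (b - a) powi m * fact (nat k)))"

text \<open>The superscript of the basis function and its last parameter coincide in
  \<open>Y\<^sub>j\<^sup>v(x; a, b, v)\<close>, so \<open>v\<close> is passed only once. The range of interest is \<open>j \<le> v\<close>.\<close>

definition Y_basis :: "nat \<Rightarrow> nat \<Rightarrow> real \<Rightarrow> real \<Rightarrow> real \<Rightarrow> real" where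
  "Y_basis j v x a b = real (v choose j) * ((x - a) ^ j * (b - x) ^ (v - j)) / (b - a) ^ v"

end

theory Submission
  imports Defs
begin

text \<open>
  Write \<open>p = x - a\<close> and \<open>q = b - x\<close>. As a function of \<open>t\<close>, \<open>f_Y k\<close> is a constant multiple of
  \<open>(p t)\<^sup>k / k! \<cdot> exp (q t)\<close>, so by the product rule differentiation acts on the family
  indexed by \<open>k\<close> (with \<open>m\<close> kept fixed) as the operator \<open>p S + q\<close>, where \<open>S\<close> lowers \<open>k\<close> by one
  (\<open>has_field_derivative_f_Y\<close>). The two summands commute, so the \<open>v\<close>-th derivative is given by the
  binomial expansion of \<open>(p S + q)\<^sup>v\<close> (\<open>higher_deriv_f_Y\<close>). What remains is bookkeeping: the
  factors \<open>(b - a)\<^sup>v\<^sup>-\<^sup>j\<close> and \<open>(b - a)\<^sup>-\<^sup>v\<close> on the right-hand side cancel against the shift from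
  \<open>m\<close> to \<open>m - j\<close> in \<open>f_Y\<close> (\<open>Y_basis_mult_f_Y\<close>).
\<close>

text \<open>The convention that \<open>f_Y\<close> vanishes for negative \<open>k\<close> makes this recurrence
  uniform: for \<open>k = 0\<close> the polynomial factor is constant and the first summand disappears.\<close>

lemma has_field_derivative_f_Y:
  "((\<lambda>s. f_Y k x s a b m) has_field_derivative
      of_real (x - a) * f_Y (k - 1) x t a b m + of_real (b - x) * f_Y k x t a b m) (at t)"
proof (cases "k \<le> 0")
  case True
  then show ?thesis
    unfolding f_Y_def
    by (cases "k = 0") (auto intro!: DERIV_cdivide derivative_eq_intros simp del: of_real_diff)
next
  case False
  define n where "n = nat (k - 1)"
  define p where "p = (of_real (x - a) :: complex)"
  define q where "q = (of_real (b - x) :: complex)"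
  define c where "c = (of_real (b - a) powi m :: complex)"
  have k: "\<not> k < 0" "\<not> k - 1 < 0" "nat k = Suc n" "nat (k - 1) = n"
    using False by (auto simp: n_def)
  have eq: "of_nat (Suc n) * z / (c * fact (Suc n)) = z / (c * fact n)" for z :: complex
    unfolding fact_Suc by (simp add: field_simps del: of_nat_Suc)
  have "((\<lambda>s. s ^ Suc n * p ^ Suc n * exp (q * s) / (c * fact (Suc n))) has_field_derivative
      of_nat (Suc n) * (p * (t ^ n * p ^ n * exp (q * t))) / (c * fact (Suc n))
      + q * (t ^ Suc n * p ^ Suc n * exp (q * t) / (c * fact (Suc n)))) (at t)"
    unfolding divide_inverse
    by (rule derivative_eq_intros refl | simp add: algebra_simps del: fact_Suc)+
  then show ?thesis
    unfolding eq unfolding f_Y_def k(3,4) if_not_P[OF k(1)] if_not_P[OF k(2)] p_def q_def c_def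
    by simp
qed

text \<open>The induction step of the binomial theorem for \<open>(p S + q)\<^sup>v\<close>, where \<open>S\<close> is the shift
  of the sequence \<open>h\<close>.\<close>

lemma binomial_shift_step:
  fixes p q :: "'a :: comm_ring_1" and h :: "nat \<Rightarrow> 'a"
  shows "(\<Sum>j\<le>v. of_nat (v choose j) * p ^ j * q ^ (v - j) * (p * h (Suc j) + q * h j)) =
         (\<Sum>j\<le>Suc v. of_nat (Suc v choose j) * p ^ j * q ^ (Suc v - j) * h j)"
proof -
  let ?A = "\<Sum>j\<le>v. of_nat (v choose j) * p ^ Suc j * q ^ (v - j) * h (Suc j)"
  have "(\<Sum>j\<le>Suc v. of_nat (Suc v choose j) * p ^ j * q ^ (Suc v - j) * h j) =
     q ^ Suc v * h 0 +
     (\<Sum>j\<le>v. of_nat (v choose Suc j) * p ^ Suc j * q ^ (v - j) * h (Suc j)) + ?A"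
    by (subst sum.atMost_Suc_shift) (simp add: algebra_simps sum.distrib)
  also have "q ^ Suc v * h 0 +
      (\<Sum>j\<le>v. of_nat (v choose Suc j) * p ^ Suc j * q ^ (v - j) * h (Suc j)) =
      (\<Sum>j\<le>Suc v. of_nat (v choose j) * p ^ j * q ^ (Suc v - j) * h j)"
    by (subst sum.atMost_Suc_shift) simp
  also have "\<dots> = (\<Sum>j\<le>v. of_nat (v choose j) * p ^ j * q ^ (v - j) * (q * h j))"
    by (simp add: Suc_diff_le mult_ac binomial_eq_0)
  finally show ?thesis
    by (simp add: sum.distrib algebra_simps)
qed

lemma higher_deriv_f_Y:
  "(deriv ^^ v) (\<lambda>s. f_Y k x s a b m) t =
    (\<Sum>j\<le>v. of_nat (v choose j) * of_real (x - a) ^ j * of_real (b - x) ^ (v - j)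
               * f_Y (k - int j) x t a b m)"
proof (induction v arbitrary: t)
  case 0
  show ?case by simp
next
  case (Suc v)
  define p where "p = (of_real (x - a) :: complex)"
  define q where "q = (of_real (b - x) :: complex)"
  define h where "h = (\<lambda>j s. f_Y (k - int j) x s a b m)"
  have h: "(h j has_field_derivative p * h (Suc j) t + q * h j t) (at t)" for j
    using has_field_derivative_f_Y[of "k - int j" x a b m t]
    by (simp add: h_def p_def q_def algebra_simps)
  have IH: "(deriv ^^ v) (\<lambda>s. f_Y k x s a b m) =
      (\<lambda>s. \<Sum>j\<le>v. of_nat (v choose j) * p ^ j * q ^ (v - j) * h j s)"
    unfolding p_def q_def h_def by (rule ext, rule Suc.IH)
  have "((\<lambda>s. \<Sum>j\<le>v. of_nat (v choose j) * p ^ j * q ^ (v - j) * h j s) has_field_derivative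
      (\<Sum>j\<le>v. of_nat (v choose j) * p ^ j * q ^ (v - j) * (p * h (Suc j) t + q * h j t))) (at t)"
    by (intro DERIV_sum DERIV_cmult h)
  then have "(deriv ^^ Suc v) (\<lambda>s. f_Y k x s a b m) t =
      (\<Sum>j\<le>v. of_nat (v choose j) * p ^ j * q ^ (v - j) * (p * h (Suc j) t + q * h j t))"
    unfolding funpow.simps o_apply IH by (rule DERIV_imp_deriv)
  also have "\<dots> = (\<Sum>j\<le>Suc v. of_nat (Suc v choose j) * p ^ j * q ^ (Suc v - j) * h j t)"
    by (rule binomial_shift_step[where h = "\<lambda>j. h j t"])
  finally show ?case
    unfolding p_def q_def h_def .
qed

lemma f_Y_diff_exponent:
  assumes "a \<noteq> b"
  shows "f_Y k x t a b (m - int j) = of_real (b - a) ^ j * f_Y k x t a b m"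
proof -
  have "(of_real (b - a) :: complex) \<noteq> 0"
    using assms by simp
  then show ?thesis
    unfolding f_Y_def by (simp add: power_int_diff del: of_real_diff)
qed

text \<open>The powers of \<open>b - a\<close> have exponents \<open>v - j\<close>, \<open>- v\<close> and, from the change of \<open>m\<close>, \<open>j\<close>;
  these add up to zero.\<close>

lemma Y_basis_mult_f_Y:
  assumes "a \<noteq> b" "j \<le> v"
  shows "of_real ((b - a) ^ (v - j)) * of_real (Y_basis j v x a b) * f_Y k x t a b (m - int j) =
    of_nat (v choose j) * of_real (x - a) ^ j * of_real (b - x) ^ (v - j) * f_Y k x t a b m"
proof -
  define d where "d = b - a"
  have "d \<noteq> 0"
    using assms by (simp add: d_def)
  moreover have "d ^ v = d ^ (v - j) * d ^ j"
    using assms by (simp flip: power_add)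
  ultimately have "d ^ (v - j) * Y_basis j v x a b * d ^ j =
      real (v choose j) * (x - a) ^ j * (b - x) ^ (v - j)"
    unfolding Y_basis_def d_def[symmetric] by simp
  then have "(of_real (d ^ (v - j) * Y_basis j v x a b * d ^ j) :: complex) =
      of_real (real (v choose j) * (x - a) ^ j * (b - x) ^ (v - j))"
    by (rule arg_cong)
  then show ?thesis
    unfolding f_Y_diff_exponent[OF assms(1)] d_def[symmetric]
    by (simp add: mult.assoc[symmetric] del: of_real_diff)
qed

theorem theorem6:
  fixes a b x :: real and t :: complex and m k :: int and v :: nat
  assumes "0 \<le> a" and "0 \<le> b" and "a \<noteq> b"
    and "x \<in> {a..b}"
    and "0 < m" and "0 \<le> k"
  shows "(deriv ^^ v) (\<lambda>s. f_Y k x s a b m) t =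
    (\<Sum>j = 0..v. of_real ((b - a) ^ (v - j)) * of_real (Y_basis j v x a b)
                   * f_Y (k - int j) x t a b (m - int j))"
  unfolding higher_deriv_f_Y atLeast0AtMost
  by (rule sum.cong[OF refl], rule Y_basis_mult_f_Y[symmetric]) (use \<open>a \<noteq> b\<close> in auto)

end
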